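(* Let $a = 1+\sqrt{2}$ and $b = 1-\sqrt{2} = -1/a$. For every positive integer $N$ and every integer $n\ge 0$, $$\sum_{i=0}^{4N-1} P(n+i) = \frac{a^{2N}-b^{2N}}{\sqrt{2}}\, P(n+2N).$$ In particular, the sum of any $4N$ consecutive Pell numbers equals a constant depending only on $N$ times the $(2N+1)$-st of these consecutive terms.
   Context: The Pell numbers are defined by $P(0)=0$, $P(1)=1$ and $P(n)=2P(n-1)+P(n-2)$ for $n\ge 2$. *)

theory Defs
  imports Complex_Main
begin

fun pell :: "nat \<Rightarrow> nat" where
  "pell 0 = 0"
| "pell (Suc 0) = 1"
| "pell (Suc (Suc n)) = 2 * pell (Suc n) + pell n"

end

theory Submission
  imports Defs
begin

text \<open>
  By Binet's formula the sum is a combination of two geometric series of ratios $a$ and $b$.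
  Since $a - 1 = \sqrt 2 = 1 - b$, four times the sum of \<open>m\<close> terms from index $n$ is
  $(a^{n+m} + b^{n+m}) - (a^n + b^n)$; for $m = 4N$ this factors as
  $(a^{2N} - b^{2N})(a^{n+2N} - b^{n+2N})$ because $(ab)^{2N} = 1$.
\<close>

text \<open>Both \<open>1 + sqrt 2\<close> and \<open>1 - sqrt 2\<close> are roots of t^2 = 2t + 1,
  so their powers obey the Pell recurrence.\<close>

lemma pell_binet:
  "2 * sqrt 2 * real (pell n) = (1 + sqrt 2) ^ n - (1 - sqrt 2) ^ n"
proof (induction n rule: pell.induct)
  case (3 n)
  have "(1 + sqrt 2) ^ Suc (Suc n) = 2 * (1 + sqrt 2) ^ Suc n + (1 + sqrt 2) ^ n"
    "(1 - sqrt 2) ^ Suc (Suc n) = 2 * (1 - sqrt 2) ^ Suc n + (1 - sqrt 2) ^ n"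
    by (simp_all add: algebra_simps)
  \<comment> \<open>Without \<open>power_Suc\<close> the powers stay atomic, so the two recurrences
    and the induction hypotheses combine linearly.\<close>
  then show ?case
    using "3.IH" by (simp add: algebra_simps del: power_Suc)
qed simp_all

text \<open>The sum telescopes: raising the exponent k by one adds sqrt 2 * a^k to a^k and -sqrt 2 *
  b^k to b^k, in total 4 P(k) by Binet.\<close>

lemma sum_pell_consecutive:
  "4 * (\<Sum>i<m. real (pell (n + i))) =
    (1 + sqrt 2) ^ (n + m) + (1 - sqrt 2) ^ (n + m) - (1 + sqrt 2) ^ n - (1 - sqrt 2) ^ n"
proof (induction m)
  case (Suc m)
  have "4 * real (pell (n + m)) = sqrt 2 * (2 * sqrt 2 * real (pell (n + m)))"
    by simp
  also have "\<dots> = sqrt 2 * ((1 + sqrt 2) ^ (n + m) - (1 - sqrt 2) ^ (n + m))"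
    by (simp only: pell_binet)
  finally show ?case
    using Suc.IH by (simp add: algebra_simps)
qed simp

lemma sum_pell_4N:
  "(\<Sum>i<4*N. real (pell (n + i))) =
    ((1 + sqrt 2) ^ (2*N) - (1 - sqrt 2) ^ (2*N)) / sqrt 2 * real (pell (n + 2*N))"
proof -
  define A B :: real where "A = (1 + sqrt 2) ^ (2*N)" and "B = (1 - sqrt 2) ^ (2*N)"
  have sq: "(1 + sqrt 2) ^ (4*N) = A * A" "(1 - sqrt 2) ^ (4*N) = B * B"
    by (simp_all add: A_def B_def flip: power_add)
  have "(1 + sqrt 2) * (1 - sqrt 2) = - 1"
    by (simp add: algebra_simps)
  \<comment> \<open>The exponent \<open>2*N\<close> is even, so the sign of -1 disappears.\<close>
  then have AB: "A * B = 1"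
    unfolding A_def B_def by (simp flip: power_mult_distrib)
  define x y :: real where "x = (1 + sqrt 2) ^ n" and "y = (1 - sqrt 2) ^ n"
  have "4 * (\<Sum>i<4*N. real (pell (n + i))) = x * (A * A) + y * (B * B) - x - y"
    by (simp add: sum_pell_consecutive power_add sq x_def y_def)
  \<comment> \<open>Expanding the product gives the cross terms -(x + y) * A * B, which equal -x - y
    by \<open>AB\<close>.\<close>
  also have "\<dots> = (A - B) * (x * A - y * B)"
    using AB by algebra
  also have "x * A - y * B = 2 * sqrt 2 * real (pell (n + 2*N))"
    by (simp only: pell_binet power_add A_def B_def x_def y_def)
  also have "(A - B) * (2 * sqrt 2 * real (pell (n + 2*N))) =
      4 * ((A - B) / sqrt 2 * real (pell (n + 2*N)))"
  proof -
    have "2 * sqrt 2 = 4 / sqrt 2"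
      by (simp add: field_simps)
    then show ?thesis
      by simp
  qed
  finally show ?thesis
    unfolding A_def B_def by simp
qed

theorem theorem1p6:
  fixes a b :: real
  assumes a: "a = 1 + sqrt 2"
    and b: "b = 1 - sqrt 2"
  shows "b = - 1 / a \<and>
    (\<forall>N::nat. N \<ge> 1 \<longrightarrow> (\<forall>n::nat.
       (\<Sum>i=0..4*N-1. real (pell (n + i)))
         = (a ^ (2*N) - b ^ (2*N)) / sqrt 2 * real (pell (n + 2*N)))) \<and>
    (\<exists>c :: nat \<Rightarrow> real. \<forall>N::nat. N \<ge> 1 \<longrightarrow> (\<forall>n::nat.
       (\<Sum>i=0..4*N-1. real (pell (n + i))) = c N * real (pell (n + 2*N))))"
proof -
  have "b = - 1 / a"
  proof -
    have "a > 0" "b * a = - 1"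
      unfolding a b by (simp_all add: algebra_simps add_pos_pos)
    then show ?thesis
      by (simp add: field_simps)
  qed
  moreover have main: "(\<Sum>i=0..4*N-1. real (pell (n + i)))
      = (a ^ (2*N) - b ^ (2*N)) / sqrt 2 * real (pell (n + 2*N))" if "N \<ge> 1" for N n :: nat
  proof -
    \<comment> \<open>This needs \<open>N \<ge> 1\<close>: at N = 0 truncated subtraction would
      leave the index 0 on the left.\<close>
    have "{0..4*N-1} = {..<4*N}"
      using that by auto
    then show ?thesis
      using sum_pell_4N a b by simp
  qed
  moreover have "\<exists>c :: nat \<Rightarrow> real. \<forall>N\<ge>1. \<forall>n.
      (\<Sum>i=0..4*N-1. real (pell (n + i))) = c N * real (pell (n + 2*N))"
    using main by (intro exI[of _ "\<lambda>N. (a ^ (2*N) - b ^ (2*N)) / sqrt 2"]) blast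
  ultimately show ?thesis
    by blast
qed

end
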